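(* Let $n\ge1$ be an integer, $c_1,\dots,c_n\in\mathbb{C}$ and $\mu_2,\dots,\mu_n\in\mathbb{C}^*$. For the complex matrix $C=\operatorname{circ}(c_1,c_2,\dots,c_n;\mu_2,\dots,\mu_n)$ define the polynomial $p_C(X)=c_1+c_2\mu_2X+c_3\mu_3X^2+\dots+c_n\mu_nX^{n-1}$. For $j\in\{1,\dots,n\}$ define $\lambda_j=p_C(\omega^{j-1})$, where $\omega=\cos(\frac{2\pi}{n})+i\sin(\frac{2\pi}{n})$. Then $\lambda_1,\dots,\lambda_n$ are the eigenvalues of $C$, and the eigenvector of $\lambda_j$ is $$x_j=(1,\mu_2\omega^{j-1},\mu_3\omega^{2(j-1)},\dots,\mu_n\omega^{(n-1)(j-1)})^T,\qquad 1\le j\le n.$$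
   Context: For $c_1,\dots,c_n\in\mathbb{C}$ and nonzero $\mu_2,\dots,\mu_n\in\mathbb{C}$, with the convention $\mu_1=1$, $\operatorname{circ}(c_1,\dots,c_n;\mu_2,\dots,\mu_n)$ denotes the $n\times n$ matrix whose $(i,j)$ entry is $c_{j-i+1}\dfrac{\mu_i\,\mu_{j-i+1}}{\mu_j}$, with subscripts taken mod $n$ in $\{1,\dots,n\}$; in particular its first row is $(c_1,\dots,c_n)$ and its diagonal entries are $c_1$. *)

theory Defs
  imports "Jordan_Normal_Form.Spectral_Radius" Complex_Main
begin

text \<open>
  The sequences \<open>c\<^sub>1,\<dots>,c\<^sub>n\<close> and \<open>\<mu>\<^sub>1,\<dots>,\<mu>\<^sub>n\<close> are functions on \<open>nat\<close> of which only the values at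
  \<open>1,\<dots>,n\<close> are used. The convention \<open>\<mu>\<^sub>1 = 1\<close> is not built into the definitions; it is to be
  assumed. Matrices and vectors of the library are indexed from \<open>0\<close>, hence the shifts by one.
\<close>

text \<open>The representative in \<open>{1..n}\<close> of an integer modulo \<open>n\<close> (for \<open>n \<ge> 1\<close>).\<close>

definition cyc_index :: "nat \<Rightarrow> int \<Rightarrow> nat" where
  "cyc_index n k = nat ((k - 1) mod int n) + 1"

definition circ_entry ::
  "nat \<Rightarrow> (nat \<Rightarrow> complex) \<Rightarrow> (nat \<Rightarrow> complex) \<Rightarrow> nat \<Rightarrow> nat \<Rightarrow> complex" where
  "circ_entry n c \<mu> i j =
     (let k = cyc_index n (int j - int i + 1) in c k * (\<mu> i * \<mu> k / \<mu> j))"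

definition circ :: "nat \<Rightarrow> (nat \<Rightarrow> complex) \<Rightarrow> (nat \<Rightarrow> complex) \<Rightarrow> complex mat" where
  "circ n c \<mu> = mat n n (\<lambda>(i, j). circ_entry n c \<mu> (i + 1) (j + 1))"

definition circ_poly :: "nat \<Rightarrow> (nat \<Rightarrow> complex) \<Rightarrow> (nat \<Rightarrow> complex) \<Rightarrow> complex poly" where
  "circ_poly n c \<mu> = (\<Sum>k = 1..n. monom (c k * \<mu> k) (k - 1))"

definition root_omega :: "nat \<Rightarrow> complex" where
  "root_omega n =
     complex_of_real (cos (2 * pi / real n)) + \<i> * complex_of_real (sin (2 * pi / real n))"

definition circ_eigval :: "nat \<Rightarrow> (nat \<Rightarrow> complex) \<Rightarrow> (nat \<Rightarrow> complex) \<Rightarrow> nat \<Rightarrow> complex" where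
  "circ_eigval n c \<mu> j = poly (circ_poly n c \<mu>) (root_omega n ^ (j - 1))"

definition circ_eigvec :: "nat \<Rightarrow> (nat \<Rightarrow> complex) \<Rightarrow> nat \<Rightarrow> complex vec" where
  "circ_eigvec n \<mu> j = vec n (\<lambda>k. \<mu> (k + 1) * root_omega n ^ (k * (j - 1)))"

end

theory Submission
  imports Defs
begin

text \<open>
  With \<open>z = \<omega>\<^bsup>j-1\<^esup>\<close>, entry \<open>i\<close> of \<open>C x\<^sub>j\<close> is \<open>\<mu>\<^sub>i\<close> times \<open>\<Sum>\<^sub>l c\<^sub>k \<mu>\<^sub>k z\<^bsup>l-1\<^esup>\<close>, where \<open>k\<close> is
  \<open>l - i + 1\<close> modulo \<open>n\<close>: the factor \<open>\<mu>\<^sub>l\<close> of the vector cancels the denominator in the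
  matrix entry. Since \<open>z\<^bsup>n\<^esup> = 1\<close>, the exponent also matters only modulo \<open>n\<close>, so the cyclic shift of
  the summation index merely pulls out \<open>z\<^bsup>i-1\<^esup>\<close>; the result is
  \<open>p\<^sub>C(z)\<close> times entry \<open>i\<close> of \<open>x\<^sub>j\<close>. Hence each \<open>x\<^sub>j\<close> is an eigenvector for \<open>\<lambda>\<^sub>j\<close>
  (lemma \<open>circ_mult_circ_eigvec\<close>).

  That the list of the \<open>\<lambda>\<^sub>j\<close> is complete, and has the right multiplicities when some of them
  coincide, holds because the \<open>x\<^sub>j\<close> form a basis. The matrix with columns \<open>x\<^sub>j\<close> is the
  Fourier matrix \<open>(\<omega>\<^bsup>kj\<^esup>)\<close> with its rows scaled by the nonzero \<open>\<mu>\<close>'s, and orthogonality of the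
  characters of \<open>\<int>/n\<int>\<close> gives an explicit inverse (lemma \<open>inverse_circ_eigvec_matrix\<close>). So \<open>C\<close> is
  similar to the diagonal matrix of the \<open>\<lambda>\<^sub>j\<close>, which determines the characteristic polynomial and,
  through its roots, the spectrum.
\<close>

text \<open>
  Reading the eigenvector equations column by column gives \<open>A P = P D\<close> with \<open>D\<close> diagonal. Since \<open>P\<close>
  is invertible, multiplicities are accounted for even if the \<open>d j\<close> are not distinct.
\<close>

lemma char_poly_eigenvector_basis:
  fixes A P Q :: "'a :: field mat"
  assumes A: "A \<in> carrier_mat n n" and P: "P \<in> carrier_mat n n" and Q: "Q \<in> carrier_mat n n"
    and QP: "Q * P = 1\<^sub>m n"
    and ev: "\<And>j. j < n \<Longrightarrow> A *\<^sub>v col P j = d j \<cdot>\<^sub>v col P j"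
  shows "char_poly A = (\<Prod>j<n. [:- d j, 1:])"
proof -
  define D where "D = mat_diag n d"
  have D: "D \<in> carrier_mat n n" by (simp add: D_def)
  have PQ: "P * Q = 1\<^sub>m n" by (rule mat_mult_left_right_inverse[OF Q P QP])
  have AP: "A * P = P * D"
  proof (rule eq_matI)
    fix i j assume "i < dim_row (P * D)" "j < dim_col (P * D)"
    then have ij: "i < n" "j < n" using P D by auto
    have "(A * P) $$ (i, j) = (A *\<^sub>v col P j) $ i" using A P ij by simp
    also have "\<dots> = d j * P $$ (i, j)" using ev[OF ij(2)] P ij by simp
    also have "\<dots> = (P * D) $$ (i, j)"
      using ij unfolding D_def by (simp add: mat_diag_mult_right[OF P] mult.commute)
    finally show "(A * P) $$ (i, j) = (P * D) $$ (i, j)" .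
  qed (use A P D in auto)
  have "A = A * (P * Q)" using A PQ by simp
  also have "\<dots> = P * D * Q" using AP assoc_mult_mat[OF A P Q] by simp
  finally have "similar_mat A D"
    using A D P Q PQ QP by (intro similar_matI[of _ _ P Q n]) auto
  then have "char_poly A = char_poly D" by (rule char_poly_similar)
  also have "\<dots> = (\<Prod>a \<leftarrow> diag_mat D. [:- a, 1:])"
    by (rule char_poly_upper_triangular[OF D]) (auto simp: D_def mat_diag_def)
  also have "\<dots> = (\<Prod>j \<leftarrow> [0..<n]. [:- d j, 1:])"
  proof -
    have "diag_mat D = map d [0..<n]"
      by (auto simp: diag_mat_def D_def mat_diag_def)
    then show ?thesis by (simp add: o_def)
  qed
  also have "\<dots> = (\<Prod>j<n. [:- d j, 1:])"
    by (subst prod.distinct_set_conv_list[symmetric]) (auto simp: atLeast0LessThan)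
  finally show ?thesis .
qed

lemma power_mod_exponent:
  fixes z :: "'a :: monoid_mult"
  assumes "z ^ n = 1"
  shows "z ^ (k mod n) = z ^ k"
proof -
  have "z ^ k = z ^ (n * (k div n) + k mod n)" by simp
  also have "\<dots> = z ^ (k mod n)" by (simp only: power_add power_mult assms) simp
  finally show ?thesis ..
qed

text \<open>
  Both the coefficient index and the exponent live in \<open>\<int>/n\<int>\<close>, so translating the summation
  variable by \<open>i\<close> is a permutation of the terms.
\<close>

lemma sum_cyclic_shift_root_of_unity:
  fixes z :: "'a :: comm_ring_1"
  assumes z: "z ^ n = 1" and i: "i < n"
  shows "(\<Sum>l<n. g (nat ((int l - int i) mod int n)) * z ^ l) = z ^ i * (\<Sum>m<n. g m * z ^ m)"
proof -
  have "(\<Sum>l<n. g (nat ((int l - int i) mod int n)) * z ^ l) = (\<Sum>m<n. g m * z ^ (m + i))"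
  proof (rule sum.reindex_bij_witness
      [where i = "\<lambda>m. (m + i) mod n" and j = "\<lambda>l. nat ((int l - int i) mod int n)"], goal_cases)
    case (1 l)
    have "int ((nat ((int l - int i) mod int n) + i) mod n) = int l"
      using 1 i by (simp add: zmod_int mod_add_left_eq)
    then show ?case by linarith
  next
    case (2 l)
    then show ?case using i by (simp add: nat_less_iff)
  next
    case (3 m)
    have "(int ((m + i) mod n) - int i) mod int n = int m"
      using 3 by (simp add: zmod_int mod_diff_left_eq)
    then show ?case by simp
  next
    case (4 m)
    then show ?case using i by simp
  next
    case (5 l)
    have "int ((nat ((int l - int i) mod int n) + i) mod n) = int l"
      using 5 i by (simp add: zmod_int mod_add_left_eq)
    then have "(nat ((int l - int i) mod int n) + i) mod n = l" by linarith
    then show ?case by (metis power_mod_exponent[OF z])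
  qed
  also have "\<dots> = z ^ i * (\<Sum>m<n. g m * z ^ m)"
    by (simp add: sum_distrib_left power_add mult_ac)
  finally show ?thesis .
qed

lemma root_omega_eq_cis: "root_omega n = cis (2 * pi / real n)"
  by (simp add: root_omega_def complex_eq_iff)

lemma root_omega_power_self: "n \<ge> 1 \<Longrightarrow> root_omega n ^ n = 1"
  by (simp add: root_omega_eq_cis DeMoivre)

lemma root_omega_nonzero: "root_omega n \<noteq> 0"
  by (simp add: root_omega_eq_cis)

lemma inj_on_root_omega_power:
  assumes "n \<ge> 1"
  shows "inj_on (\<lambda>k. root_omega n ^ k) {..<n}"
proof -
  have "(\<lambda>k. root_omega n ^ k) = (\<lambda>k. cis (2 * pi * real k / real n))"
    by (simp add: root_omega_eq_cis DeMoivre mult_ac)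
  then show ?thesis using bij_betw_roots_unity[of n] assms by (simp add: bij_betw_def)
qed

text \<open>
  Orthogonality of characters: for \<open>i \<noteq> j\<close> the ratio \<open>\<omega>\<^bsup>j\<^esup>/\<omega>\<^bsup>i\<^esup>\<close> is a root of unity other than
  \<open>1\<close>, and its geometric sum vanishes.
\<close>

lemma sum_root_omega_ratio_powers:
  assumes n: "n \<ge> 1" and ij: "i < n" "j < n"
  shows "(\<Sum>k<n. (root_omega n ^ j / root_omega n ^ i) ^ k) = (if i = j then of_nat n else 0)"
proof -
  let ?q = "root_omega n ^ j / root_omega n ^ i"
  have "?q = 1 \<longleftrightarrow> i = j"
    using inj_on_root_omega_power[OF n] ij root_omega_nonzero[of n]
    by (auto simp: inj_on_def)
  moreover have "?q ^ n = 1"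
    by (simp add: power_divide power_mult[symmetric] mult.commute[of _ n])
       (simp add: power_mult root_omega_power_self[OF n] root_omega_nonzero)
  ultimately show ?thesis by (simp add: sum_gp_strict)
qed

lemma circ_eigval_eq_sum:
  "circ_eigval n c \<mu> (j + 1) = (\<Sum>m<n. c (m + 1) * \<mu> (m + 1) * (root_omega n ^ j) ^ m)"
  by (simp add: circ_eigval_def circ_poly_def poly_sum poly_monom sum.atLeast1_atMost_eq)

lemma circ_mult_circ_eigvec:
  assumes n: "n \<ge> 1" and \<mu>: "\<And>i. i < n \<Longrightarrow> \<mu> (i + 1) \<noteq> 0"
  shows "circ n c \<mu> *\<^sub>v circ_eigvec n \<mu> (j + 1)
    = circ_eigval n c \<mu> (j + 1) \<cdot>\<^sub>v circ_eigvec n \<mu> (j + 1)"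
proof (rule eq_vecI)
  fix i assume "i < dim_vec (circ_eigval n c \<mu> (j + 1) \<cdot>\<^sub>v circ_eigvec n \<mu> (j + 1))"
  then have i: "i < n" by (simp add: circ_eigvec_def)
  define z where "z = root_omega n ^ j"
  have z: "z ^ n = 1"
    by (simp add: z_def power_mult[symmetric] mult.commute[of j])
       (simp add: power_mult root_omega_power_self[OF n])
  let ?g = "\<lambda>m. c (m + 1) * \<mu> (m + 1)"
  have "(circ n c \<mu> *\<^sub>v circ_eigvec n \<mu> (j + 1)) $ i
      = (\<Sum>l<n. circ_entry n c \<mu> (i + 1) (l + 1) * (\<mu> (l + 1) * root_omega n ^ (l * j)))"
    using i by (simp add: circ_def circ_eigvec_def scalar_prod_def atLeast0LessThan)
  also have "\<dots> = (\<Sum>l<n. \<mu> (i + 1) * (?g (nat ((int l - int i) mod int n)) * z ^ l))"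
  proof (rule sum.cong[OF refl], goal_cases)
    case (1 l)
    then show ?case using \<mu>[of l]
      by (simp add: circ_entry_def cyc_index_def Let_def z_def mult.commute[of l j] power_mult)
  qed
  also have "\<dots> = \<mu> (i + 1) * (z ^ i * (\<Sum>m<n. ?g m * z ^ m))"
    using sum_cyclic_shift_root_of_unity[OF z i, of ?g] by (simp only: sum_distrib_left[symmetric])
  also have "\<dots> = (circ_eigval n c \<mu> (j + 1) \<cdot>\<^sub>v circ_eigvec n \<mu> (j + 1)) $ i"
    using i unfolding circ_eigval_eq_sum
    by (simp add: circ_eigvec_def z_def mult.commute[of i j] power_mult[symmetric])
  finally show "(circ n c \<mu> *\<^sub>v circ_eigvec n \<mu> (j + 1)) $ i
      = (circ_eigval n c \<mu> (j + 1) \<cdot>\<^sub>v circ_eigvec n \<mu> (j + 1)) $ i" .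
qed (simp add: circ_def circ_eigvec_def)

text \<open>
  The inverse is the conjugate Fourier matrix divided by \<open>n\<close>, with its columns scaled to undo the
  weights \<open>\<mu>\<close>.
\<close>

lemma inverse_circ_eigvec_matrix:
  assumes n: "n \<ge> 1" and \<mu>: "\<And>i. i < n \<Longrightarrow> \<mu> (i + 1) \<noteq> 0"
  shows "mat n n (\<lambda>(i, k). 1 / (of_nat n * \<mu> (k + 1) * root_omega n ^ (i * k)))
      * mat n n (\<lambda>(k, j). circ_eigvec n \<mu> (j + 1) $ k) = 1\<^sub>m n" (is "?Q * ?P = _")
proof (rule eq_matI)
  fix i j assume "i < dim_row (1\<^sub>m n :: complex mat)" "j < dim_col (1\<^sub>m n :: complex mat)"
  then have ij: "i < n" "j < n" by auto
  have "(?Q * ?P) $$ (i, j) = (\<Sum>k<n. 1 / (of_nat n * \<mu> (k + 1) * root_omega n ^ (i * k))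
      * (\<mu> (k + 1) * root_omega n ^ (k * j)))"
    using ij by (simp add: scalar_prod_def atLeast0LessThan circ_eigvec_def)
  also have "\<dots> = (\<Sum>k<n. (root_omega n ^ j / root_omega n ^ i) ^ k / of_nat n)"
    using \<mu> by (intro sum.cong refl)
      (simp add: power_divide power_mult[symmetric] mult.commute[of _ j])
  also have "\<dots> = (if i = j then 1 else 0)"
    using sum_root_omega_ratio_powers[OF n ij] n by (simp add: sum_divide_distrib[symmetric])
  finally show "(?Q * ?P) $$ (i, j) = 1\<^sub>m n $$ (i, j)" using ij by simp
qed simp_all

theorem proposition5p2:
  fixes n :: nat and c \<mu> :: "nat \<Rightarrow> complex"
  assumes "n \<ge> 1"
    and "\<mu> 1 = 1"
    and "\<And>i. i \<in> {2..n} \<Longrightarrow> \<mu> i \<noteq> 0"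
  shows "spectrum (circ n c \<mu>) = circ_eigval n c \<mu> ` {1..n}
    \<and> char_poly (circ n c \<mu>) = (\<Prod>j = 1..n. [:- circ_eigval n c \<mu> j, 1:])
    \<and> (\<forall>j \<in> {1..n}. eigenvector (circ n c \<mu>) (circ_eigvec n \<mu> j) (circ_eigval n c \<mu> j))"
proof (intro conjI ballI)
  have \<mu>: "\<mu> (i + 1) \<noteq> 0" if "i < n" for i
    using that assms(2) assms(3)[of "i + 1"] by (cases i) auto
  let ?C = "circ n c \<mu>"
  have C: "?C \<in> carrier_mat n n" by (simp add: circ_def)
  let ?P = "mat n n (\<lambda>(k, j). circ_eigvec n \<mu> (j + 1) $ k)"
  have col: "col ?P j = circ_eigvec n \<mu> (j + 1)" if "j < n" for j
    using that by (intro eq_vecI) (auto simp: circ_eigvec_def)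
  have "char_poly ?C = (\<Prod>j<n. [:- circ_eigval n c \<mu> (j + 1), 1:])"
  proof (rule char_poly_eigenvector_basis[OF C _ _ inverse_circ_eigvec_matrix[of n \<mu>, OF assms(1) \<mu>]])
    show "?C *\<^sub>v col ?P j = circ_eigval n c \<mu> (j + 1) \<cdot>\<^sub>v col ?P j" if "j < n" for j
      unfolding col[OF that] by (rule circ_mult_circ_eigvec[of n \<mu>, OF assms(1) \<mu>])
  qed simp_all
  then show cp: "char_poly ?C = (\<Prod>j = 1..n. [:- circ_eigval n c \<mu> j, 1:])"
    by (simp add: prod.atLeast1_atMost_eq)
  show "spectrum ?C = circ_eigval n c \<mu> ` {1..n}"
    by (auto simp: spectrum_def eigenvalue_root_char_poly[OF C] cp poly_prod intro!: bexI)
  fix j assume j: "j \<in> {1..n}"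
  \<comment> \<open>The vector is nonzero because its first entry is \<open>\<mu>\<^sub>1 = 1\<close>.\<close>
  have "circ_eigvec n \<mu> j $ 0 = 1" using assms(1,2) by (simp add: circ_eigvec_def)
  then have "circ_eigvec n \<mu> j \<noteq> 0\<^sub>v n" using assms(1) by auto
  moreover have "?C *\<^sub>v circ_eigvec n \<mu> j = circ_eigval n c \<mu> j \<cdot>\<^sub>v circ_eigvec n \<mu> j"
    using circ_mult_circ_eigvec[of n \<mu> c "j - 1", OF assms(1) \<mu>] j by simp
  ultimately show "eigenvector ?C (circ_eigvec n \<mu> j) (circ_eigval n c \<mu> j)"
    using C by (auto simp: eigenvector_def circ_eigvec_def)
qed

end
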